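(* Let $k\geq 2$ be an integer such that the crown graph $S_k^0$ is connected. Then, for every $\gamma_R$-function $f$ of $S_k^0$, the minimum roman dominating distance energy of $S_k^0$ (computed from $f$) is $$E_{RDd}(S_k^0)=7k-6+\sqrt{k^2-4k+12}.$$
   Context: Graphs are finite and simple. The crown graph $S_k^0$ is the bipartite graph with vertex classes $\{a_1,\dots,a_k\}$ and $\{b_1,\dots,b_k\}$ in which $a_i$ is adjacent to $b_j$ if and only if $i\neq j$. A Roman dominating function (RDF) on a connected graph $G=(V,E)$ is a function $f:V\to\{0,1,2\}$ such that every vertex $u$ with $f(u)=0$ is adjacent to at least one vertex $v$ with $f(v)=2$. Its weight is $\sum_{v\in V}f(v)$; $\gamma_R(G)$ is the minimum weight of an RDF of $G$, and an RDF of weight $\gamma_R(G)$ is called a $\gamma_R$-function. Write $V_i=\{v\in V: f(v)=i\}$. For a connected graph $G$ with vertices $v_1,\dots,v_n$ and a $\gamma_R$-function $f$ of $G$, the minimum roman dominating distance matrix $A_{RDd}(G)=(\bar d_{ij})$ is the real symmetric $n\times n$ matrix with $\bar d_{ii}=2$ if $v_i\in V_2$, $\bar d_{ii}=1$ if $v_i\in V_1$, $\bar d_{ii}=0$ if $v_i\in V_0$, and $\bar d_{ij}=d(v_i,v_j)$ (graph distance) for $i\ne j$. The minimum roman dominating distance energy is $E_{RDd}(G)=\sum_{l=1}^n|\rho_l|$, where $\rho_1,\dots,\rho_n$ are the eigenvalues of $A_{RDd}(G)$ with multiplicity. *)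

theory Defs
  imports
    "Graph_Theory.Graph_Theory"
    "Jordan_Normal_Form.Char_Poly"
begin

text \<open>
  A finite simple graph is a \<open>pair_graph\<close>: its arc set is a symmetric irreflexive relation
  on a finite vertex set, and it contains both orientations of every edge.
\<close>

definition crown_graph :: "nat \<Rightarrow> (nat + nat) pair_pre_digraph" where
  "crown_graph k =
    \<lparr> pverts = Inl ` {1..k} \<union> Inr ` {1..k},
      parcs = (\<Union>i\<in>{1..k}. \<Union>j\<in>{1..k} - {i}. {(Inl i, Inr j), (Inr j, Inl i)}) \<rparr>"

lemma pair_graph_crown_graph: "pair_graph (crown_graph k)"
proof
  show "finite (parcs (crown_graph k))"
    by (auto simp: crown_graph_def)
  show "symmetric (with_proj (crown_graph k))"
    by (auto simp: crown_graph_def symmetric_def sym_def)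
qed (auto simp: crown_graph_def)

definition roman_dominating :: "'v pair_pre_digraph \<Rightarrow> ('v \<Rightarrow> nat) \<Rightarrow> bool" where
  "roman_dominating G f \<longleftrightarrow>
    (\<forall>v\<in>pverts G. f v \<in> {0, 1, 2}) \<and>
    (\<forall>u\<in>pverts G. f u = 0 \<longrightarrow> (\<exists>v\<in>pverts G. (u, v) \<in> parcs G \<and> f v = 2))"

definition rdf_weight :: "'v pair_pre_digraph \<Rightarrow> ('v \<Rightarrow> nat) \<Rightarrow> nat" where
  "rdf_weight G f = (\<Sum>v\<in>pverts G. f v)"

definition roman_domination_number :: "'v pair_pre_digraph \<Rightarrow> nat" where
  "roman_domination_number G = (LEAST w. \<exists>f. roman_dominating G f \<and> rdf_weight G f = w)"

definition gamma_R_function :: "'v pair_pre_digraph \<Rightarrow> ('v \<Rightarrow> nat) \<Rightarrow> bool" where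
  "gamma_R_function G f \<longleftrightarrow>
    roman_dominating G f \<and> rdf_weight G f = roman_domination_number G"

text \<open>
  The library's distance takes values in the extended reals (it is \<open>\<infinity>\<close> between vertices
  of different components); in a connected graph it is always finite.
\<close>

definition graph_dist :: "'v pair_pre_digraph \<Rightarrow> 'v \<Rightarrow> 'v \<Rightarrow> real" where
  "graph_dist G u v = real_of_ereal (wf_digraph.\<mu> (with_proj G) (\<lambda>_. 1) u v)"

text \<open>
  The list \<open>vs\<close> is the enumeration \<open>v\<^sub>1, \<dots>, v\<^sub>n\<close> of the vertices, with indices shifted to
  start from 0. The diagonal entry 2, 1, 0 for a vertex of \<open>V\<^sub>2\<close>, \<open>V\<^sub>1\<close>, \<open>V\<^sub>0\<close> is the value
  of \<open>f\<close>.
\<close>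

definition rdd_matrix :: "'v pair_pre_digraph \<Rightarrow> ('v \<Rightarrow> nat) \<Rightarrow> 'v list \<Rightarrow> real mat" where
  "rdd_matrix G f vs = mat (length vs) (length vs)
    (\<lambda>(i, j). if i = j then real (f (vs ! i)) else graph_dist G (vs ! i) (vs ! j))"

text \<open>
  \<open>proots\<close> is the multiset of roots with multiplicity. The matrix is real symmetric, so the
  real roots of its characteristic polynomial are all its eigenvalues.
\<close>

definition rdd_energy :: "'v pair_pre_digraph \<Rightarrow> ('v \<Rightarrow> nat) \<Rightarrow> 'v list \<Rightarrow> real" where
  "rdd_energy G f vs = (\<Sum>\<rho>\<in>#proots (char_poly (rdd_matrix G f vs)). \<bar>\<rho>\<bar>)"

end

theory Submission
  imports Defs
begin

text \<open>
  Connectedness forces \<open>k \<ge> 3\<close>; then the distances in the crown graph are 2 within a class, 1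
  between adjacent vertices and 3 between \<open>a\<^sub>i\<close> and \<open>b\<^sub>i\<close>, and a \<open>\<gamma>\<^sub>R\<close>-function takes the value 2
  exactly on one pair \<open>a\<^sub>p, b\<^sub>p\<close> and vanishes elsewhere. Listing \<open>a\<^sub>p\<close> and \<open>b\<^sub>p\<close> first in their
  classes, the matrix has the block form \<open>[[A, B], [B, A]]\<close>, with \<open>A + B = 3J + 2E\<close> and
  \<open>A - B = J - 4I + 2E\<close>, where \<open>J\<close> is the all-ones matrix and \<open>E\<close> the unit matrix at the first
  position. Both are scalar matrices plus matrices of rank two, so the characteristic polynomial is
  \<open>X^(k-2) (X + 4)^(k-2) (X^2 - (3k+2) X + 6(k-1)) (X^2 - (k-6) X + 6 - 2k)\<close>. The first quadratic
  has nonnegative roots, contributing their sum; the roots of the second have product at most 0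
  and contribute their difference.
\<close>

section \<open>Connectedness and distances in the crown graph\<close>

text \<open>With unit arc weights the cost of a walk is its length, so the infimum defining the
  distance is attained at a shortest walk \<open>p\<close>.\<close>

lemma graph_dist_eqI:
  assumes "pair_wf_digraph G" and "pre_digraph.awalk (with_proj G) u p v"
    and "\<And>q. pre_digraph.awalk (with_proj G) u q v \<Longrightarrow> length p \<le> length q"
  shows "graph_dist G u v = real (length p)"
proof -
  interpret pair_wf_digraph G by (fact assms(1))
  have cost: "awalk_cost (\<lambda>_. 1) q = real (length q)" for q :: "('a \<times> 'a) list"
    by (induction q) auto
  have "\<mu> (\<lambda>_. 1) u v = ereal (real (length p))"
    unfolding \<mu>_def cost by (rule INF_eqI) (use assms in auto)
  then show ?thesis
    by (simp add: graph_dist_def)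
qed

lemma pverts_crown_graph: "pverts (crown_graph k) = Inl ` {1..k} \<union> Inr ` {1..k}"
  by (simp add: crown_graph_def)

lemma parcs_crown_graph [simp]:
  "(Inl i, Inl j) \<notin> parcs (crown_graph k)"
  "(Inr i, Inr j) \<notin> parcs (crown_graph k)"
  "(Inl i, Inr j) \<in> parcs (crown_graph k) \<longleftrightarrow> i \<in> {1..k} \<and> j \<in> {1..k} \<and> i \<noteq> j"
  "(Inr i, Inl j) \<in> parcs (crown_graph k) \<longleftrightarrow> i \<in> {1..k} \<and> j \<in> {1..k} \<and> i \<noteq> j"
  by (auto simp: crown_graph_def)

text \<open>For \<open>k = 2\<close> the graph consists of two disjoint edges: no arc leaves the set
  \<open>{Inl 1, Inr 2}\<close>, so no walk from \<open>Inl 1\<close> reaches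
  \<open>Inr 1\<close>.\<close>

lemma connected_crown_graph_imp_ge_3:
  assumes "k \<ge> 2" and "connected (with_proj (crown_graph k))"
  shows "k \<ge> 3"
proof (rule ccontr)
  assume "\<not> k \<ge> 3"
  with assms have k: "k = 2" by simp
  interpret pair_graph "crown_graph k" by (rule pair_graph_crown_graph)
  have "strongly_connected (with_proj (crown_graph k))"
    using assms(2) symmetric_connected_imp_strongly_connected sym_arcs by blast
  then have "reachable (with_proj (crown_graph k)) (Inl 1) (Inr 1)"
    unfolding strongly_connected_def by (auto simp: pverts_crown_graph k)
  then obtain p where "awalk (Inl 1) p (Inr 1)"
    by (auto simp: reachable_awalk)
  moreover have "v \<in> {Inl 1, Inr 2}" if "awalk u q v" "u \<in> {Inl 1, Inr 2}" for u q v
    using that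
  proof (induction q arbitrary: u)
    case (Cons e q)
    then have "e \<in> parcs (crown_graph k)" "u = fst e"
      by (auto simp: awalk_Cons_iff)
    with Cons.prems have "snd e \<in> {Inl 1, Inr 2}"
      by (cases e; cases "snd e") (auto simp: k)
    with Cons show ?case
      by (auto simp: awalk_Cons_iff)
  qed (auto simp: awalk_Nil_iff)
  ultimately show False by fastforce
qed

context
  fixes k :: nat
  assumes k: "k \<ge> 3"
begin

interpretation pair_graph "crown_graph k" by (rule pair_graph_crown_graph)

text \<open>Supplies the inner vertices of the explicit shortest walks; \<open>i\<close> and
  \<open>j\<close> may coincide.\<close>

lemma exists_third_index:
  obtains l where "l \<in> {1..k}" "l \<noteq> i" "l \<noteq> j"
proof -
  have "card ({1..k} - {i, j}) \<ge> k - card {i, j}"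
    using diff_card_le_card_Diff[of "{i, j}" "{1..k}"] by simp
  moreover have "card {i, j} \<le> 2" by (simp add: card_insert_if)
  ultimately have "card ({1..k} - {i, j}) > 0" using k by linarith
  then show thesis using that by (metis Diff_iff card_gt_0_iff ex_in_conv insertCI)
qed

text \<open>No arc joins two vertices of one class, so a walk needs at least two arcs; passing
  through the partner class at a third index \<open>l\<close> attains this.\<close>

lemma graph_dist_crown_graph_same_side:
  assumes "i \<in> {1..k}" "j \<in> {1..k}" "i \<noteq> j"
  shows "graph_dist (crown_graph k) (Inl i) (Inl j) = 2"
    and "graph_dist (crown_graph k) (Inr i) (Inr j) = 2"
proof -
  obtain l where l: "l \<in> {1..k}" "l \<noteq> i" "l \<noteq> j" by (rule exists_third_index)
  have "graph_dist (crown_graph k) (Inl i) (Inl j)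
      = real (length [(Inl i :: nat + nat, Inr l :: nat + nat), (Inr l, Inl j)])"
  proof (rule graph_dist_eqI)
    fix q assume q: "awalk (Inl i) q (Inl j)"
    show "length [(Inl i :: nat + nat, Inr l :: nat + nat), (Inr l, Inl j)] \<le> length q"
      using q assms by (cases q; cases "tl q") (auto simp: awalk_simps)
  qed (use assms l in \<open>auto simp: awalk_simps pverts_crown_graph\<close>)
  then show "graph_dist (crown_graph k) (Inl i) (Inl j) = 2" by simp
  have "graph_dist (crown_graph k) (Inr i) (Inr j)
      = real (length [(Inr i :: nat + nat, Inl l :: nat + nat), (Inl l, Inr j)])"
  proof (rule graph_dist_eqI)
    fix q assume q: "awalk (Inr i) q (Inr j)"
    show "length [(Inr i :: nat + nat, Inl l :: nat + nat), (Inl l, Inr j)] \<le> length q"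
      using q assms by (cases q; cases "tl q") (auto simp: awalk_simps)
  qed (use assms l in \<open>auto simp: awalk_simps pverts_crown_graph\<close>)
  then show "graph_dist (crown_graph k) (Inr i) (Inr j) = 2" by simp
qed

lemma graph_dist_crown_graph_adjacent:
  assumes "(u, v) \<in> parcs (crown_graph k)"
  shows "graph_dist (crown_graph k) u v = 1"
proof -
  have "u \<noteq> v" and "u \<in> pverts (crown_graph k)" and "v \<in> pverts (crown_graph k)"
    using assms no_loops' wellformed[OF assms] by auto
  have "graph_dist (crown_graph k) u v = real (length [(u, v)])"
  proof (rule graph_dist_eqI)
    fix q assume q: "awalk u q v"
    show "length [(u, v)] \<le> length q"
      using q \<open>u \<noteq> v\<close> by (cases q) (auto simp: awalk_simps)
  qed (use assms \<open>v \<in> pverts (crown_graph k)\<close> in \<open>auto simp: awalk_simps pair_wf_digraph_axioms\<close>)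
  then show ?thesis by simp
qed

text \<open>The walk zigzags through the indices \<open>i, l, m, i\<close>. Nothing shorter exists:
  the endpoints are distinct and not adjacent, and a walk with two arcs returns to its starting
  class.\<close>

lemma graph_dist_crown_graph_antipodal:
  assumes "i \<in> {1..k}"
  shows "graph_dist (crown_graph k) (Inl i) (Inr i) = 3"
    and "graph_dist (crown_graph k) (Inr i) (Inl i) = 3"
proof -
  obtain l where l: "l \<in> {1..k}" "l \<noteq> i" by (rule exists_third_index)
  obtain m where m: "m \<in> {1..k}" "m \<noteq> i" "m \<noteq> l" by (rule exists_third_index)
  have three: "length q \<ge> 3"
    if "awalk u q v" "(u, v) = (Inl i, Inr i) \<or> (u, v) = (Inr i, Inl i)" for u q v
  proof (rule ccontr)
    assume "\<not> length q \<ge> 3"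
    then consider "q = []" | e where "q = [e]" | e e' where "q = [e, e']"
      by (cases q; cases "tl q"; cases "tl (tl q)") auto
    then show False
    proof cases
      case (3 e e')
      with that show False by (cases "snd e") (cases e; cases e'; auto simp: awalk_simps)+
    qed (use that in \<open>auto simp: awalk_simps\<close>)
  qed
  have "graph_dist (crown_graph k) (Inl i) (Inr i) = real (length
      [(Inl i :: nat + nat, Inr l :: nat + nat), (Inr l, Inl m), (Inl m, Inr i)])"
    using assms l m three pair_wf_digraph_axioms
    by (intro graph_dist_eqI) (auto simp: awalk_simps pverts_crown_graph Suc_le_eq numeral_3_eq_3)
  then show "graph_dist (crown_graph k) (Inl i) (Inr i) = 3" by simp
  have "graph_dist (crown_graph k) (Inr i) (Inl i) = real (length
      [(Inr i :: nat + nat, Inl l :: nat + nat), (Inl l, Inr m), (Inr m, Inl i)])"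
    using assms l m three pair_wf_digraph_axioms
    by (intro graph_dist_eqI) (auto simp: awalk_simps pverts_crown_graph Suc_le_eq numeral_3_eq_3)
  then show "graph_dist (crown_graph k) (Inr i) (Inl i) = 3" by simp
qed

end

section \<open>Minimum Roman dominating functions of the crown graph\<close>

lemma sum_crown_graph:
  "(\<Sum>v\<in>pverts (crown_graph k). f v) = (\<Sum>i\<in>{1..k}. f (Inl i)) + (\<Sum>i\<in>{1..k}. f (Inr i))"
  unfolding pverts_crown_graph by (subst sum.union_disjoint) (auto simp: sum.reindex)

text \<open>If \<open>g\<close> never takes the value 2, then \<open>h\<close> has no zero. A
  positive \<open>g\<close> would bring the total to at least \<open>2 * k\<close>, so
  \<open>g\<close> has a zero and \<open>h j = 2\<close> for some \<open>j\<close>. Then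
  \<open>h\<close> sums to at least \<open>k + 1\<close>, which forces \<open>g = 0\<close>; now
  \<open>g j = 0\<close> demands a second 2 of \<open>h\<close>, and the total is at least
  \<open>k + 2\<close>. Abstract \<open>g\<close> and \<open>h\<close> let the two classes swap
  roles.\<close>

lemma exists_two_of_light:
  fixes g h :: "nat \<Rightarrow> nat"
  assumes k: "k \<ge> 3"
    and g: "\<And>i. i \<in> {1..k} \<Longrightarrow> g i = 0 \<Longrightarrow> \<exists>j\<in>{1..k}. j \<noteq> i \<and> h j = 2"
    and h: "\<And>i. i \<in> {1..k} \<Longrightarrow> h i = 0 \<Longrightarrow> \<exists>j\<in>{1..k}. j \<noteq> i \<and> g j = 2"
    and light: "(\<Sum>i\<in>{1..k}. g i) + (\<Sum>i\<in>{1..k}. h i) \<le> 4"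
  shows "\<exists>i\<in>{1..k}. g i = 2"
proof (rule ccontr)
  assume no: "\<not> (\<exists>i\<in>{1..k}. g i = 2)"
  with h have h1: "h i \<ge> 1" if "i \<in> {1..k}" for i
    using that by (metis less_one not_le)
  have card_le: "card A \<le> sum h A" if "A \<subseteq> {1..k}" for A
    using sum_mono[of A "\<lambda>_. 1" h] h1 that by (simp add: subset_iff)
  have "\<exists>i\<in>{1..k}. g i = 0"
  proof (rule ccontr)
    assume "\<not> ?thesis"
    then have "(\<Sum>i\<in>{1..k}. 1) \<le> sum g {1..k}"
      by (intro sum_mono) (auto simp: Suc_le_eq)
    with light card_le[of "{1..k}"] k show False by auto
  qed
  then obtain i j where i: "i \<in> {1..k}" and j: "j \<in> {1..k}" "h j = 2"
    using g by blast
  have "sum h {1..k} = 2 + sum h ({1..k} - {j})"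
    using j by (simp add: sum.remove)
  moreover have "card ({1..k} - {j}) = k - 1"
    using j by simp
  moreover have "card ({1..k} - {j}) \<le> sum h ({1..k} - {j})"
    by (rule card_le) auto
  ultimately have "sum h {1..k} \<ge> k + 1"
    using k by linarith
  with light k have "sum g {1..k} = 0" by linarith
  then have "g j = 0" using j by simp
  with g j obtain l where l: "l \<in> {1..k}" "l \<noteq> j" "h l = 2" by blast
  have "sum h {1..k} = 4 + sum h ({1..k} - {j} - {l})"
    using sum.remove[OF _ j(1), of h] sum.remove[of "{1..k} - {j}" l h] l
    by (simp only: j(2) l(3) finite_atLeastAtMost finite_Diff Diff_iff singleton_iff) simp
  moreover have "card ({1..k} - {j} - {l}) = k - 2"
    using j l by simp
  moreover have "card ({1..k} - {j} - {l}) \<le> sum h ({1..k} - {j} - {l})"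
    by (rule card_le) auto
  ultimately show False
    using k light by linarith
qed

lemma gamma_R_function_crown_graph:
  assumes k: "k \<ge> 3" and f: "gamma_R_function (crown_graph k) f"
  shows "\<exists>p\<in>{1..k}. \<forall>i\<in>{1..k}.
    f (Inl i) = (if i = p then 2 else 0) \<and> f (Inr i) = (if i = p then 2 else 0)"
proof -
  \<comment> \<open>The competitor \<open>f0\<close> bounds the weight by 4: \<open>Inl 1\<close>
    and \<open>Inr 1\<close> each dominate every vertex of the other class except each
    other.\<close>
  define f0 :: "nat + nat \<Rightarrow> nat" where "f0 = (\<lambda>v. if v = Inl 1 \<or> v = Inr 1 then 2 else 0)"
  have "roman_dominating (crown_graph k) f0"
    unfolding roman_dominating_def
  proof (intro conjI ballI impI)
    fix u assume u: "u \<in> pverts (crown_graph k)" "f0 u = 0"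
    show "\<exists>v\<in>pverts (crown_graph k). (u, v) \<in> parcs (crown_graph k) \<and> f0 v = 2"
    proof (cases u)
      case (Inl i)
      then show ?thesis
        using u k by (intro bexI[of _ "Inr 1"]) (auto simp: f0_def pverts_crown_graph)
    next
      case (Inr i)
      then show ?thesis
        using u k by (intro bexI[of _ "Inl 1"]) (auto simp: f0_def pverts_crown_graph)
    qed
  qed (simp add: f0_def)
  moreover have "rdf_weight (crown_graph k) f0 = 4"
    using k by (simp add: rdf_weight_def sum_crown_graph f0_def sum.delta)
  ultimately have "roman_domination_number (crown_graph k) \<le> 4"
    unfolding roman_domination_number_def by (intro Least_le) blast
  with f have dom: "roman_dominating (crown_graph k) f" and "rdf_weight (crown_graph k) f \<le> 4"
    by (auto simp: gamma_R_function_def)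
  then have light: "(\<Sum>i\<in>{1..k}. f (Inl i)) + (\<Sum>i\<in>{1..k}. f (Inr i)) \<le> 4"
    by (simp add: rdf_weight_def sum_crown_graph)
  then have light': "(\<Sum>i\<in>{1..k}. f (Inr i)) + (\<Sum>i\<in>{1..k}. f (Inl i)) \<le> 4"
    by linarith
  have nbr: "\<exists>v\<in>pverts (crown_graph k). (u, v) \<in> parcs (crown_graph k) \<and> f v = 2"
    if "u \<in> pverts (crown_graph k)" "f u = 0" for u
    using dom that by (auto simp: roman_dominating_def)
  have l: "\<exists>j\<in>{1..k}. j \<noteq> i \<and> f (Inr j) = 2" if "i \<in> {1..k}" "f (Inl i) = 0" for i
    using nbr[of "Inl i"] that by (auto simp: pverts_crown_graph)
  have r: "\<exists>j\<in>{1..k}. j \<noteq> i \<and> f (Inl j) = 2" if "i \<in> {1..k}" "f (Inr i) = 0" for i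
    using nbr[of "Inr i"] that by (auto simp: pverts_crown_graph)
  obtain p where p: "p \<in> {1..k}" "f (Inl p) = 2"
    using exists_two_of_light[OF k l r light] by blast
  obtain q where q: "q \<in> {1..k}" "f (Inr q) = 2"
    using exists_two_of_light[OF k r l light'] by blast
  \<comment> \<open>One value 2 in each class already uses up the weight 4, so everything else
    vanishes.\<close>
  have "(\<Sum>i\<in>{1..k}. f (Inl i)) = 2 + (\<Sum>i\<in>{1..k} - {p}. f (Inl i))"
    "(\<Sum>i\<in>{1..k}. f (Inr i)) = 2 + (\<Sum>i\<in>{1..k} - {q}. f (Inr i))"
    using sum.remove[OF _ p(1), of "\<lambda>i. f (Inl i)"] sum.remove[OF _ q(1), of "\<lambda>i. f (Inr i)"]
    by (simp_all only: p(2) q(2) finite_atLeastAtMost)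
  with light have rest: "(\<Sum>i\<in>{1..k} - {p}. f (Inl i)) = 0" "(\<Sum>i\<in>{1..k} - {q}. f (Inr i)) = 0"
    by linarith+
  have zero: "f (Inl i) = 0" if "i \<in> {1..k}" "i \<noteq> p" for i
    using rest(1) that by simp
  have zero': "f (Inr i) = 0" if "i \<in> {1..k}" "i \<noteq> q" for i
    using rest(2) that by simp
  \<comment> \<open>Otherwise \<open>Inl q\<close> has value 0, while the only 2 in the other class
    sits at \<open>Inr q\<close>, which is not adjacent to it.\<close>
  have "p = q"
    using l[of q] zero[of q] zero' q by (metis zero_neq_numeral)
  with p q zero zero' show ?thesis by (intro bexI[of _ p]) auto
qed

section \<open>Determinant identities\<close>

text \<open>Changing the enumeration permutes rows and columns alike, so the sign of the permutation
  enters twice and cancels. This permits a convenient vertex order.\<close>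

lemma det_mat_enumeration:
  fixes g :: "'a \<Rightarrow> 'a \<Rightarrow> 'b :: comm_ring_1"
  assumes "distinct vs" "distinct ws" "set vs = set ws"
  shows "det (mat (length vs) (length vs) (\<lambda>(i, j). g (vs ! i) (vs ! j)))
       = det (mat (length ws) (length ws) (\<lambda>(i, j). g (ws ! i) (ws ! j)))"
proof -
  have "mset vs = mset ws" using assms by (simp add: set_eq_iff_mset_eq_distinct)
  then obtain p where p: "p permutes {..<length ws}" and vs: "permute_list p ws = vs"
    by (rule mset_eq_permutation)
  define n where "n = length ws"
  define A where "A = mat n n (\<lambda>(i, j). g (ws ! i) (ws ! j))"
  define B where "B = mat n n (\<lambda>(i, j). A $$ (p i, j))"
  have [simp]: "length vs = n" using vs n_def by auto
  have p': "p permutes {0..<n}" using p by (simp add: n_def atLeast0LessThan)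
  have nth: "vs ! i = ws ! p i" if "i < n" for i
    using that p vs by (auto simp: n_def permute_list_nth)
  have lt: "p i < n" if "i < n" for i
    using that permutes_in_image[OF p, of i] by (simp add: n_def)
  have A: "A \<in> carrier_mat n n" and B: "B \<in> carrier_mat n n" by (auto simp: A_def B_def)
  \<comment> \<open>\<open>B\<close> has permuted rows; permuting the rows of its transpose and
    transposing back permutes the columns.\<close>
  have "mat n n (\<lambda>(i, j). g (vs ! i) (vs ! j))
      = transpose_mat (mat n n (\<lambda>(i, j). transpose_mat B $$ (p i, j)))"
    by (intro eq_matI) (auto simp: A_def B_def nth lt)
  also have "det \<dots> = det (mat n n (\<lambda>(i, j). transpose_mat B $$ (p i, j)))"
    by (rule det_transpose[where n = n]) auto
  also have "\<dots> = signof p * (signof p * det A)"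
    using det_permute_rows[OF A p'] det_permute_rows[OF _ p', of "transpose_mat B"]
      det_transpose[OF B] B by (simp add: B_def)
  also have "\<dots> = det A" by (simp add: sign_def)
  finally show ?thesis by (simp add: A_def n_def)
qed

text \<open>Adding the second block row to the first (\<open>?U\<close>) and then subtracting the
  first block column from the second (\<open>?V\<close>) leaves a block triangular matrix; both
  operations have determinant 1.\<close>

lemma det_four_block_mat_symmetric:
  fixes A B :: "'a :: idom mat"
  assumes A: "A \<in> carrier_mat n n" and B: "B \<in> carrier_mat n n"
  shows "det (four_block_mat A B B A) = det (A + B) * det (A - B)"
proof -
  let ?U = "four_block_mat (1\<^sub>m n) (1\<^sub>m n) (0\<^sub>m n n) (1\<^sub>m n) :: 'a mat"
  let ?V = "four_block_mat (1\<^sub>m n) (- 1\<^sub>m n) (0\<^sub>m n n) (1\<^sub>m n) :: 'a mat"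
  let ?M = "four_block_mat A B B A"
  have U: "?U \<in> carrier_mat (n + n) (n + n)" and V: "?V \<in> carrier_mat (n + n) (n + n)"
    and M: "?M \<in> carrier_mat (n + n) (n + n)" using A by auto
  have "?U * ?M = four_block_mat (A + B) (B + A) B A"
    using A B by (subst mult_four_block_mat[where ?n1.0 = n and ?n2.0 = n]) auto
  also have "\<dots> * ?V = four_block_mat (A + B) (0\<^sub>m n n) B (A - B)"
    using A B
    by (subst mult_four_block_mat[where ?n1.0 = n and ?n2.0 = n])
       auto
  finally have "det (?U * ?M * ?V) = det (A + B) * det (A - B)"
    by (simp only:) (rule det_four_block_mat_upper_right_zero[OF _ refl], use A B in auto)
  moreover have "det (?U * ?M * ?V) = det ?U * det ?M * det ?V"
    using det_mult[OF U M] det_mult[OF mult_carrier_mat[OF U M] V] by simp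
  moreover have "det ?U = 1" "det ?V = 1"
    by (simp_all add: det_four_block_mat_lower_left_zero[where n = n and m = n])
  ultimately show ?thesis by simp
qed

lemma det_carrier_mat_2:
  assumes "A \<in> carrier_mat 2 2"
  shows "det (A :: 'a :: comm_ring_1 mat) = A $$ (0, 0) * A $$ (1, 1) - A $$ (1, 0) * A $$ (0, 1)"
proof -
  have "det (mat_delete A i 0) = mat_delete A i 0 $$ (0, 0)" for i
    using assms by (intro det_single) (auto simp: mat_delete_def)
  then show ?thesis
    using assms laplace_expansion_column[OF assms, of 0]
    by (simp add: numeral_2_eq_2 cofactor_def mat_delete_def)
qed

text \<open>
  The unitriangular matrix \<open>P\<close> changes to the basis \<open>e\<^sub>0, w = e\<^sub>1 + \<dots> + e\<^sub>n\<^sub>+\<^sub>1, e\<^sub>2, \<dots>, e\<^sub>n\<^sub>+\<^sub>1\<close>.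
  The all-ones matrix and the unit matrix at \<open>(0, 0)\<close> map everything into the span of \<open>e\<^sub>0\<close> and \<open>w\<close>,
  so the matrix becomes block triangular.
\<close>

lemma det_diag_minus_rank_two:
  fixes y c e :: "'a :: idom"
  shows "det (mat (n + 2) (n + 2)
      (\<lambda>(i, j). (if i = j then y else 0) - c - (if i = 0 \<and> j = 0 then e else 0)))
    = y ^ n * (y ^ 2 - (c * of_nat (n + 2) + e) * y + e * c * of_nat (n + 1))"
proof -
  let ?m = "n + 2"
  define N where "N = mat ?m ?m
      (\<lambda>(i, j). (if i = j then y else 0) - c - (if i = 0 \<and> j = 0 then e else 0))"
  define P :: "'a mat" where "P = mat ?m ?m
      (\<lambda>(i, j). if i = j \<or> j = 1 \<and> i \<ge> 1 then 1 else 0)"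
  define T1 where "T1 = mat 2 2 (\<lambda>(i, j).
      if i = 0 then if j = 0 then y - c - e else - c * of_nat (n + 1)
      else if j = 0 then - c else y - c * of_nat (n + 1))"
  define T where "T = four_block_mat T1 (mat 2 n (\<lambda>_. - c)) (0\<^sub>m n 2) (y \<cdot>\<^sub>m 1\<^sub>m n)"
  have N: "N \<in> carrier_mat ?m ?m" and P: "P \<in> carrier_mat ?m ?m" and T: "T \<in> carrier_mat ?m ?m"
    by (auto simp: N_def P_def T_def T1_def)
  have detP: "det P = 1"
  proof -
    have "det P = prod_list (diag_mat P)"
      by (rule det_lower_triangular[OF _ P]) (auto simp: P_def)
    also have "\<dots> = 1" by (simp add: prod_list_diag_prod P_def)
    finally show ?thesis .
  qed
  have NP: "N * P = P * T"
  proof (rule eq_matI)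
    fix i j assume "i < dim_row (P * T)" and "j < dim_col (P * T)"
    then have i: "i < ?m" and j: "j < ?m" using P T by auto
    \<comment> \<open>Row \<open>i\<close> of \<open>P\<close> has a 1 at position \<open>i\<close>
      and, for \<open>i \<ge> 2\<close>, another at position 1.\<close>
    have PTij: "(P * T) $$ (i, j) = T $$ (i, j) + (if i \<ge> 2 then T $$ (1, j) else 0)"
    proof -
      have "(P * T) $$ (i, j) = (\<Sum>l<?m. P $$ (i, l) * T $$ (l, j))"
        using i j P T by (simp add: scalar_prod_def atLeast0LessThan)
      also have "\<dots> = (\<Sum>l<?m. (if l = i then T $$ (i, j) else 0)
          + (if l = 1 then (if i \<ge> 2 then T $$ (1, j) else 0) else 0))"
        by (rule sum.cong) (use i in \<open>auto simp: P_def\<close>)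
      also have "\<dots> = T $$ (i, j) + (if i \<ge> 2 then T $$ (1, j) else 0)"
        using i by (simp add: sum.distrib)
      finally show ?thesis .
    qed
    have NPij: "(N * P) $$ (i, j) = (\<Sum>l<?m. N $$ (i, l) * P $$ (l, j))"
      using i j N P by (simp add: scalar_prod_def atLeast0LessThan)
    show "(N * P) $$ (i, j) = (P * T) $$ (i, j)"
    proof (cases "j = 1")
      case False
      have "(N * P) $$ (i, j) = (\<Sum>l<?m. if l = j then N $$ (i, j) else 0)"
        unfolding NPij by (rule sum.cong) (use j False in \<open>auto simp: P_def\<close>)
      also have "\<dots> = N $$ (i, j)" using j by simp
      finally show ?thesis
        unfolding PTij using i j False
        by (auto simp: N_def T_def T1_def)
    next
      case True
      have "(N * P) $$ (i, j) = (\<Sum>l<?m. (if l = 0 then 0 else N $$ (i, l)))"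
        unfolding NPij by (rule sum.cong) (use j True in \<open>auto simp: P_def\<close>)
      also have "\<dots> = (\<Sum>l<n + 1. N $$ (i, Suc l))"
        using sum.lessThan_Suc_shift[of "\<lambda>l. if l = 0 then 0 else N $$ (i, l)" "n + 1"] by simp
      \<comment> \<open>After the shift the diagonal sits at \<open>l = i - 1\<close>. For
        \<open>i = 0\<close> truncated subtraction gives \<open>l = 0\<close>, and the inner
        conditional keeps \<open>y\<close> out of that row.\<close>
      also have "\<dots> = (\<Sum>l<n + 1. (if l = i - 1 then (if i \<ge> 1 then y else 0) else 0) - c)"
        by (rule sum.cong) (use i in \<open>auto simp: N_def\<close>)
      also have "\<dots> = (if i \<ge> 1 then y else 0) - c * of_nat (n + 1)"
        using i unfolding sum_subtractf sum.delta[OF finite_lessThan] by (auto simp: less_Suc_eq)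
      finally show ?thesis
        unfolding PTij using i True by (auto simp: T_def T1_def)
    qed
  qed (use N P T in auto)
  have "det N * det P = det P * det T"
    using NP det_mult[OF N P] det_mult[OF P T] by metis
  then have "det N = det T" by (simp add: detP)
  also have "\<dots> = det T1 * y ^ n"
    unfolding T_def
    by (subst det_four_block_mat_lower_left_zero[where n = 2 and m = n])
       (auto simp: T1_def)
  also have "det T1 = (y - c - e) * (y - c * of_nat (n + 1)) - c * (c * of_nat (n + 1))"
    by (subst det_carrier_mat_2) (auto simp: T1_def)
  finally show ?thesis
    unfolding N_def by (simp add: algebra_simps power2_eq_square)
qed

section \<open>Sums of absolute values of polynomial roots\<close>

lemma sum_abs_proots_mult:
  fixes p q :: "real poly"
  assumes "p \<noteq> 0" "q \<noteq> 0"
  shows "(\<Sum>\<rho>\<in>#proots (p * q). \<bar>\<rho>\<bar>) = (\<Sum>\<rho>\<in>#proots p. \<bar>\<rho>\<bar>) + (\<Sum>\<rho>\<in>#proots q. \<bar>\<rho>\<bar>)"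
  using assms by (simp add: proots_mult)

lemma sum_abs_proots_linear_power:
  "(\<Sum>\<rho>\<in>#proots ([:a, 1:] ^ n). \<bar>\<rho>\<bar>) = real n * \<bar>a :: real\<bar>"
  by (induction n) (simp_all add: sum_abs_proots_mult algebra_simps del: mult_pCons_left)

text \<open>A square root \<open>d\<close> of the discriminant, of either sign, splits the quadratic
  into linear factors.\<close>

lemma sum_abs_proots_quadratic:
  fixes b c d :: real
  assumes "d\<^sup>2 = b\<^sup>2 - 4 * c"
  shows "(\<Sum>\<rho>\<in>#proots [:c, - b, 1:]. \<bar>\<rho>\<bar>) = \<bar>(b + d) / 2\<bar> + \<bar>(b - d) / 2\<bar>"
proof -
  have "[:c, - b, 1:] = [:- ((b + d) / 2), 1:] * [:- ((b - d) / 2), 1:]"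
    using assms by (simp add: field_simps power2_eq_square)
  then have "(\<Sum>\<rho>\<in>#proots [:c, - b, 1:]. \<bar>\<rho>\<bar>)
      = (\<Sum>\<rho>\<in>#proots [:- ((b + d) / 2), 1:]. \<bar>\<rho>\<bar>) + (\<Sum>\<rho>\<in>#proots [:- ((b - d) / 2), 1:]. \<bar>\<rho>\<bar>)"
    by (metis sum_abs_proots_mult pCons_eq_0_iff one_neq_zero)
  then show ?thesis by simp
qed

section \<open>The characteristic polynomial of the distance matrix\<close>

text \<open>Distinctness turns equality of indices into equality of vertices, so that entries depend
  on vertices only, as \<open>det_mat_enumeration\<close> requires.\<close>

lemma char_poly_rdd_matrix:
  assumes "distinct vs"
  shows "char_poly (rdd_matrix G f vs) = det (mat (length vs) (length vs)
    (\<lambda>(i, j). if vs ! i = vs ! j then [:- real (f (vs ! i)), 1:]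
              else [:- graph_dist G (vs ! i) (vs ! j):]))"
  unfolding char_poly_def char_poly_matrix_def rdd_matrix_def
  by (rule arg_cong[where f = det], rule eq_matI)
     (use assms in \<open>auto simp: nth_eq_iff_index_eq\<close>)

lemma char_poly_rdd_matrix_crown_graph:
  assumes k: "k \<ge> 3" and f: "gamma_R_function (crown_graph k) f"
    and vs: "distinct vs" "set vs = pverts (crown_graph k)"
  shows "char_poly (rdd_matrix (crown_graph k) f vs)
    = [:0, 1:] ^ (k - 2) * [:6 * (real k - 1), - (3 * real k + 2), 1:]
      * ([:4, 1:] ^ (k - 2) * [:6 - 2 * real k, - (real k - 6), 1:])"
proof -
  obtain p where p: "p \<in> {1..k}"
    and fl: "\<And>i. i \<in> {1..k} \<Longrightarrow> f (Inl i) = (if i = p then 2 else 0)"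
    and fr: "\<And>i. i \<in> {1..k} \<Longrightarrow> f (Inr i) = (if i = p then 2 else 0)"
    using gamma_R_function_crown_graph[OF k f] by blast
  define us where "us = p # sorted_list_of_set ({1..k} - {p})"
  define ws :: "(nat + nat) list" where "ws = map Inl us @ map Inr us"
  define g where "g = (\<lambda>u v. if u = v then [:- real (f u), 1:]
    else [:- graph_dist (crown_graph k) u v:])"
  \<comment> \<open>\<open>A\<close> and \<open>B\<close> are the blocks of \<open>X I - M\<close>
    for the distance matrix \<open>M\<close>, hence the negative signs.\<close>
  define A where "A = mat k k (\<lambda>(i, j).
    if i = j then if i = 0 then [:- 2, 1:] else [:0, 1:] else [:- 2 :: real:])"
  define B where "B = mat k k (\<lambda>(i, j). if i = j then [:- 3:] else [:- 1 :: real:])"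
  have [simp]: "dim_row A = k" "dim_col A = k"
    by (simp_all add: A_def)
  have us: "distinct us" "set us = {1..k}" "length us = k"
    using p by (auto simp: us_def)
  have ws: "distinct ws" "set ws = pverts (crown_graph k)" "length ws = k + k"
    using us by (auto simp: ws_def distinct_map pverts_crown_graph inj_on_def)
  have us_in: "us ! i \<in> {1..k}" if "i < k" for i
    using that us nth_mem by blast
  have us_eq: "us ! i = us ! j \<longleftrightarrow> i = j" if "i < k" "j < k" for i j
    using that us by (simp add: nth_eq_iff_index_eq)
  have us_p: "us ! i = p \<longleftrightarrow> i = 0" if "i < k" for i
    using us_eq[of i 0] that k by (simp add: us_def)
  have gA: "g (Inl (us ! i)) (Inl (us ! j)) = A $$ (i, j)"
    "g (Inr (us ! i)) (Inr (us ! j)) = A $$ (i, j)" if "i < k" "j < k" for i j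
    using that us_in[of i] us_in[of j]
    by (auto simp: g_def A_def us_eq us_p fl fr graph_dist_crown_graph_same_side[OF k])
  have gB: "g (Inl (us ! i)) (Inr (us ! j)) = B $$ (i, j)"
    "g (Inr (us ! i)) (Inl (us ! j)) = B $$ (i, j)" if "i < k" "j < k" for i j
    using that us_in[of i] us_in[of j]
    by (auto simp: g_def B_def us_eq graph_dist_crown_graph_adjacent[OF k]
        graph_dist_crown_graph_antipodal[OF k])
  have blocks: "mat (length ws) (length ws) (\<lambda>(i, j). g (ws ! i) (ws ! j)) = four_block_mat A B B A"
  proof (rule eq_matI)
    fix i j assume "i < dim_row (four_block_mat A B B A)" "j < dim_col (four_block_mat A B B A)"
    then have "i < k + k" "j < k + k" by (auto simp: A_def B_def)
    then show "mat (length ws) (length ws) (\<lambda>(i, j). g (ws ! i) (ws ! j)) $$ (i, j)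
        = four_block_mat A B B A $$ (i, j)"
      using us(3) ws(3) by (auto simp: ws_def nth_append gA gB)
  qed (use ws in \<open>auto simp: A_def B_def\<close>)
  have k2: "k - 2 + 2 = k" "real (k - 2 + 1) = real k - 1" using k by auto
  \<comment> \<open>\<open>A + B\<close> is \<open>X I - 3 J - 2 E\<close>; the size is written
    \<open>k - 2 + 2\<close> to fit \<open>det_diag_minus_rank_two\<close>.\<close>
  have "A + B = mat (k - 2 + 2) (k - 2 + 2) (\<lambda>(i, j).
      (if i = j then [:0, 1:] else 0) - 3 - (if i = 0 \<and> j = 0 then 2 else 0))"
    by (rule eq_matI) (use k in \<open>auto simp: A_def B_def numeral_poly\<close>)
  also have "det \<dots> = [:0, 1:] ^ (k - 2) * [:6 * (real k - 1), - (3 * real k + 2), 1:]"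
    unfolding det_diag_minus_rank_two unfolding k2(1)
    using k2(2) by (simp add: of_nat_poly numeral_poly power2_eq_square algebra_simps)
  finally have plus: "det (A + B) = \<dots>" .
  \<comment> \<open>Here the scalar part is \<open>X + 4\<close>; expanding the quadratic in
    \<open>X + 4\<close> gives the one in \<open>X\<close>.\<close>
  have "A - B = mat (k - 2 + 2) (k - 2 + 2) (\<lambda>(i, j).
      (if i = j then [:4, 1:] else 0) - 1 - (if i = 0 \<and> j = 0 then 2 else 0))"
    by (rule eq_matI) (use k in \<open>auto simp: A_def B_def numeral_poly one_pCons\<close>)
  also have "det \<dots> = [:4, 1:] ^ (k - 2) * [:6 - 2 * real k, - (real k - 6), 1:]"
    unfolding det_diag_minus_rank_two unfolding k2(1)
    using k2(2) by (simp add: of_nat_poly numeral_poly power2_eq_square algebra_simps)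
  finally have minus: "det (A - B) = \<dots>" .
  have "char_poly (rdd_matrix (crown_graph k) f vs)
      = det (mat (length vs) (length vs) (\<lambda>(i, j). g (vs ! i) (vs ! j)))"
    unfolding g_def by (rule char_poly_rdd_matrix[OF vs(1)])
  also have "\<dots> = det (four_block_mat A B B A)"
    unfolding blocks[symmetric] by (rule det_mat_enumeration) (use vs ws in auto)
  also have "\<dots> = det (A + B) * det (A - B)"
    by (rule det_four_block_mat_symmetric[where n = k]) (auto simp: A_def B_def)
  finally show ?thesis by (simp only: plus minus)
qed

theorem theorem3p6:
  fixes k :: nat and f :: "nat + nat \<Rightarrow> nat" and vs :: "(nat + nat) list"
  assumes "k \<ge> 2"
    and "connected (with_proj (crown_graph k))"
    and "gamma_R_function (crown_graph k) f"
    and "distinct vs" and "set vs = pverts (crown_graph k)"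
  shows "rdd_energy (crown_graph k) f vs = 7 * real k - 6 + sqrt (real k ^ 2 - 4 * real k + 12)"
proof -
  have k: "k \<ge> 3" using connected_crown_graph_imp_ge_3 assms by blast
  then have k': "real k \<ge> 3" by simp
  define d where "d = sqrt ((3 * real k + 2)\<^sup>2 - 4 * (6 * (real k - 1)))"
  define d' where "d' = sqrt (real k ^ 2 - 4 * real k + 12)"
  \<comment> \<open>Completing the square shows that the discriminant is positive.\<close>
  have "(3 * real k + 2)\<^sup>2 - 4 * (6 * (real k - 1)) = (3 * real k - 2)\<^sup>2 + 24"
    by (simp add: power2_eq_square algebra_simps)
  then have "0 \<le> (3 * real k + 2)\<^sup>2 - 4 * (6 * (real k - 1))"
    by (simp del: right_diff_distrib_numeral)
  then have d_sq: "d\<^sup>2 = (3 * real k + 2)\<^sup>2 - 4 * (6 * (real k - 1))" and "0 \<le> d"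
    unfolding d_def by (simp_all only: real_sqrt_pow2 real_sqrt_ge_zero)
  \<comment> \<open>Both roots are thus nonnegative, and their absolute values add up to their
    sum.\<close>
  have "d\<^sup>2 \<le> (3 * real k + 2)\<^sup>2"
    unfolding d_sq using k' by simp
  then have "d \<le> 3 * real k + 2"
    by (rule power2_le_imp_le) simp
  with \<open>0 \<le> d\<close> have plus: "(\<Sum>\<rho>\<in>#proots [:6 * (real k - 1), - (3 * real k + 2), 1:]. \<bar>\<rho>\<bar>) = 3 * real k + 2"
    unfolding sum_abs_proots_quadratic[OF d_sq] by (simp add: field_simps)
  have "real k ^ 2 - 4 * real k + 12 = (real k - 2)\<^sup>2 + 8"
    by (simp add: power2_eq_square algebra_simps)
  then have "0 \<le> real k ^ 2 - 4 * real k + 12"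
    by (simp only:) simp
  then have d'_sq: "d'\<^sup>2 = real k ^ 2 - 4 * real k + 12" and "0 \<le> d'"
    unfolding d'_def by (simp_all only: real_sqrt_pow2 real_sqrt_ge_zero)
  \<comment> \<open>The square root in the claimed energy is that of the discriminant of the second
    quadratic.\<close>
  have disc: "d'\<^sup>2 = (real k - 6)\<^sup>2 - 4 * (6 - 2 * real k)"
    unfolding d'_sq by (simp add: power2_eq_square algebra_simps)
  \<comment> \<open>The product \<open>6 - 2 * real k\<close> of the roots is at most 0 since
    \<open>k \<ge> 3\<close>, so the absolute values add up to the difference
    \<open>d'\<close>.\<close>
  have "\<bar>real k - 6\<bar>\<^sup>2 \<le> d'\<^sup>2"
    unfolding power2_abs disc using k' by simp
  then have "\<bar>real k - 6\<bar> \<le> d'"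
    using \<open>0 \<le> d'\<close> by (rule power2_le_imp_le)
  then have minus: "(\<Sum>\<rho>\<in>#proots [:6 - 2 * real k, - (real k - 6), 1:]. \<bar>\<rho>\<bar>) = d'"
    unfolding sum_abs_proots_quadratic[OF disc] by (simp add: field_simps)
  have "rdd_energy (crown_graph k) f vs
      = real (k - 2) * \<bar>0\<bar> + (3 * real k + 2) + (real (k - 2) * \<bar>4\<bar> + d')"
    unfolding rdd_energy_def char_poly_rdd_matrix_crown_graph[OF k assms(3-5)]
    by (simp only: sum_abs_proots_mult sum_abs_proots_linear_power plus minus mult_eq_0_iff
        power_eq_0_iff pCons_eq_0_iff one_neq_zero simp_thms)
  then show ?thesis
    using k by (simp add: d'_def of_nat_diff algebra_simps)
qed

end
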